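(* Let $\mathbb{H}$ be a complex Hilbert space, let $A\neq 0$ be a positive bounded linear operator on $\mathbb{H}$, let $\epsilon\in[0,1)$ and let $T,S\in B_{A^{1/2}}(\mathbb{H})$. Then the following conditions are equivalent: (i) $T\bot_{\epsilon(A)}S$. (ii) For each $\theta\in[0,\pi)$ there exist sequences $\{x_{n(\theta)}\},\{y_{n(\theta)}\}\subseteq S_{\mathbb{H}(A)}$ such that (a) $\lim_{n\to\infty}\|Tx_{n(\theta)}\|_A=\lim_{n\to\infty}\|Ty_{n(\theta)}\|_A=\|T\|_A$; (b) $\lim_{n\to\infty}\mathrm{Re}\big(e^{-i\theta}\langle Tx_{n(\theta)},Sx_{n(\theta)}\rangle_A\big)\ge-\epsilon\|T\|_A\|S\|_A$; (c) $\lim_{n\to\infty}\mathrm{Re}\big(e^{-i\theta}\langle Ty_{n(\theta)},Sy_{n(\theta)}\rangle_A\big)\le\epsilon\|T\|_A\|S\|_A$ (where the limits in (b) and (c) are in particular asserted to exist).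
   Context: A bounded linear operator $A$ on $\mathbb{H}$ is positive if $A=A^*$ and $\langle Ax,x\rangle\ge0$ for all $x$. Put $\langle x,y\rangle_A=\langle Ax,y\rangle$ (linear in the first argument), $\|x\|_A=\sqrt{\langle Ax,x\rangle}$, and $S_{\mathbb{H}(A)}=\{x\in\mathbb{H}:\|x\|_A=1\}$. $B_{A^{1/2}}(\mathbb{H})$ is the set of $A$-bounded operators, i.e. bounded linear operators $T$ on $\mathbb{H}$ for which there is $c>0$ with $\|Tx\|_A\le c\|x\|_A$ for all $x\in\mathbb{H}$; for such $T$, $\|T\|_A=\sup\{\|Tx\|_A:\|x\|_A=1\}$. For $T,S\in B_{A^{1/2}}(\mathbb{H})$, $T\bot_{\epsilon(A)}S$ means $\|T+\lambda S\|_A^2\ge\|T\|_A^2-2\epsilon\|T\|_A\|\lambda S\|_A$ for all scalars $\lambda$. *)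

theory Defs
  imports "HOL-Analysis.Analysis"
begin

text \<open>
  Complex inner product spaces. The real structure of the superclass
  \<^class>\<open>real_normed_vector\<close> is the restriction of scalars, and its norm is the one induced by the
  inner product, which is linear in the \<^emph>\<open>first\<close> argument.
\<close>

class complex_inner = real_normed_vector +
  fixes scaleC :: "complex \<Rightarrow> 'a \<Rightarrow> 'a"  (infixr "*\<^sub>C" 75)
    and cinner :: "'a \<Rightarrow> 'a \<Rightarrow> complex"
  assumes scaleC_add_right: "a *\<^sub>C (x + y) = a *\<^sub>C x + a *\<^sub>C y"
    and scaleC_add_left: "(a + b) *\<^sub>C x = a *\<^sub>C x + b *\<^sub>C x"
    and scaleC_scaleC: "a *\<^sub>C (b *\<^sub>C x) = (a * b) *\<^sub>C x"
    and scaleC_one: "1 *\<^sub>C x = x"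
    and scaleC_of_real: "complex_of_real r *\<^sub>C x = r *\<^sub>R x"
    and cinner_add_left: "cinner (x + y) z = cinner x z + cinner y z"
    and cinner_scaleC_left: "cinner (a *\<^sub>C x) y = a * cinner x y"
    and cinner_commute: "cinner x y = cnj (cinner y x)"
    and cinner_ge_zero: "0 \<le> Re (cinner x x)"
    and cinner_eq_zero_iff: "cinner x x = 0 \<longleftrightarrow> x = 0"
    and norm_eq_sqrt_cinner: "norm x = sqrt (Re (cinner x x))"

class complex_hilbert = complex_inner + complete_space

instantiation complex :: complex_hilbert
begin

definition scaleC_complex :: "complex \<Rightarrow> complex \<Rightarrow> complex"
  where "scaleC_complex a x = a * x"

definition cinner_complex :: "complex \<Rightarrow> complex \<Rightarrow> complex"
  where "cinner_complex x y = x * cnj y"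

instance
proof
  fix x :: complex
  show "norm x = sqrt (Re (cinner x x))"
    by (simp add: cinner_complex_def cmod_def power2_eq_square)
qed (auto simp: scaleC_complex_def cinner_complex_def algebra_simps scaleR_conv_of_real)

end

definition bounded_clinear :: "('a::complex_inner \<Rightarrow> 'b::complex_inner) \<Rightarrow> bool"
  where "bounded_clinear T \<longleftrightarrow> bounded_linear T \<and> (\<forall>c x. T (c *\<^sub>C x) = c *\<^sub>C T x)"

definition is_adjoint :: "('a::complex_inner \<Rightarrow> 'b::complex_inner) \<Rightarrow> ('b \<Rightarrow> 'a) \<Rightarrow> bool"
  where "is_adjoint T T' \<longleftrightarrow> (\<forall>x y. cinner (T x) y = cinner x (T' y))"

text \<open>Self-adjointness makes \<^term>\<open>cinner (A x) x\<close> real, so its sign is that of its real part.\<close>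

definition positive_operator :: "('a::complex_inner \<Rightarrow> 'a) \<Rightarrow> bool"
  where "positive_operator A \<longleftrightarrow>
    bounded_clinear A \<and> is_adjoint A A \<and> (\<forall>x. 0 \<le> Re (cinner (A x) x))"

definition inner_A :: "('a::complex_inner \<Rightarrow> 'a) \<Rightarrow> 'a \<Rightarrow> 'a \<Rightarrow> complex"
  where "inner_A A x y = cinner (A x) y"

definition norm_A :: "('a::complex_inner \<Rightarrow> 'a) \<Rightarrow> 'a \<Rightarrow> real"
  where "norm_A A x = sqrt (Re (inner_A A x x))"

definition sphere_A :: "('a::complex_inner \<Rightarrow> 'a) \<Rightarrow> 'a set"
  where "sphere_A A = {x. norm_A A x = 1}"

definition A_bounded_operators :: "('a::complex_inner \<Rightarrow> 'a) \<Rightarrow> ('a \<Rightarrow> 'a) set"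
  where "A_bounded_operators A =
    {T. bounded_clinear T \<and> (\<exists>c>0. \<forall>x. norm_A A (T x) \<le> c * norm_A A x)}"

text \<open>For positive \<open>A \<noteq> 0\<close> and \<open>A\<close>-bounded \<open>T\<close> the supremum is over a nonempty bounded set.\<close>

definition opnorm_A :: "('a::complex_inner \<Rightarrow> 'a) \<Rightarrow> ('a \<Rightarrow> 'a) \<Rightarrow> real"
  where "opnorm_A A T = (SUP x\<in>sphere_A A. norm_A A (T x))"

definition approx_orthogonal_A ::
    "real \<Rightarrow> ('a::complex_inner \<Rightarrow> 'a) \<Rightarrow> ('a \<Rightarrow> 'a) \<Rightarrow> ('a \<Rightarrow> 'a) \<Rightarrow> bool"
  where "approx_orthogonal_A \<epsilon> A T S \<longleftrightarrow>
    (\<forall>l::complex. (opnorm_A A (\<lambda>x. T x + l *\<^sub>C S x))\<^sup>2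
       \<ge> (opnorm_A A T)\<^sup>2 - 2 * \<epsilon> * opnorm_A A T * opnorm_A A (\<lambda>x. l *\<^sub>C S x))"

end

theory Submission
  imports Defs
begin

text \<open>
  For unimodular \<open>c\<close>, the expansion of the seminorm gives
  \<open>\<parallel>(T + t c S) x\<parallel>\<^sup>2 = \<parallel>T x\<parallel>\<^sup>2 + 2 t Re (cnj c \<langle>T x, S x\<rangle>) + t\<^sup>2 \<parallel>S x\<parallel>\<^sup>2\<close>. A sequence maximising
  \<open>\<parallel>T x\<parallel>\<close> whose cross terms tend to \<open>b \<ge> - K\<close> therefore yields
  \<open>\<parallel>T + t c S\<parallel>\<^sup>2 \<ge> \<parallel>T\<parallel>\<^sup>2 - 2 t K\<close> for all \<open>t \<ge> 0\<close>. Conversely, given these inequalities, choose \<open>x\<^sub>n\<close>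
  maximising \<open>\<parallel>(T + t c S) x\<parallel>\<^sup>2\<close> up to \<open>t\<^sup>2\<close> for \<open>t = 1 / (n + 1)\<close>, and pass to a subsequence along
  which the bounded cross terms converge. The theorem applies this equivalence to
  \<open>c = e\<^sup>i\<^sup>\<theta>\<close> (sequence \<open>x\<close>) and \<open>c = - e\<^sup>i\<^sup>\<theta>\<close> (sequence \<open>y\<close>) with
  \<open>K = \<epsilon> \<parallel>T\<parallel> \<parallel>S\<parallel>\<close>.
\<close>

text \<open>The angles of the theorem fill only a half circle, so the radius \<open>t\<close> may be
  negative: an argument outside [0, pi) is shifted by pi and the sign goes into
  \<open>t\<close>.\<close>

lemma complex_half_plane_polar:
  obtains t \<theta> :: real where "0 \<le> \<theta>" "\<theta> < pi" "l = complex_of_real t * exp (\<i> * \<theta>)"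
proof (cases "0 \<le> Arg l \<and> Arg l < pi")
  case True
  show ?thesis
  proof (cases "l = 0")
    case True
    with that[of 0 0] show ?thesis by simp
  next
    case False
    with True Arg_eq[of l] that[of "Arg l" "norm l"] show ?thesis by simp
  qed
next
  case False
  then have "l \<noteq> 0" by (auto simp: Arg_zero)
  then have l: "l = norm l * exp (\<i> * Arg l)" by (rule Arg_eq)
  consider "Arg l < 0" | "Arg l = pi"
    using False Arg_le_pi[of l] by linarith
  then show ?thesis
  proof cases
    case 1
    have "exp (\<i> * complex_of_real (Arg l + pi)) = - exp (\<i> * Arg l)"
      by (simp add: distrib_left exp_add)
    with l 1 mpi_less_Arg[of l] that[of "Arg l + pi" "- norm l"] show ?thesis
      by (simp del: of_real_add)
  next
    case 2
    with l that[of 0 "- norm l"] show ?thesis by simp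
  qed
qed

text \<open>Meant for \<open>simp only\<close> calls: the full simplifier would break the real part
  of a complex product into components.\<close>

lemma Re_mult_of_real: "Re (complex_of_real r * z) = r * Re z"
  by simp

section \<open>The semi-inner product of a positive operator\<close>

context
  fixes A :: "'h::complex_inner \<Rightarrow> 'h"
  assumes pos: "positive_operator A"
begin

lemma A_add: "A (x + y) = A x + A y"
  using pos unfolding positive_operator_def bounded_clinear_def
  by (auto intro: linear_add bounded_linear.linear)

lemma A_scaleC: "A (c *\<^sub>C x) = c *\<^sub>C A x"
  using pos unfolding positive_operator_def bounded_clinear_def by auto

lemma inner_A_add_left: "inner_A A (x + y) z = inner_A A x z + inner_A A y z"
  by (simp add: inner_A_def A_add cinner_add_left)

lemma inner_A_scaleC_left: "inner_A A (c *\<^sub>C x) y = c * inner_A A x y"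
  by (simp add: inner_A_def A_scaleC cinner_scaleC_left)

lemma inner_A_commute: "inner_A A x y = cnj (inner_A A y x)"
  using pos unfolding positive_operator_def is_adjoint_def inner_A_def
  by (metis cinner_commute)

lemma inner_A_add_right: "inner_A A x (y + z) = inner_A A x y + inner_A A x z"
  by (metis inner_A_add_left inner_A_commute complex_cnj_add)

lemma inner_A_scaleC_right: "inner_A A x (c *\<^sub>C y) = cnj c * inner_A A x y"
  by (metis inner_A_scaleC_left inner_A_commute complex_cnj_mult)

lemma norm_A_nonneg: "0 \<le> norm_A A x"
  using pos by (simp add: norm_A_def inner_A_def positive_operator_def)

lemma norm_A_sq: "(norm_A A x)\<^sup>2 = Re (inner_A A x x)"
  using pos by (simp add: norm_A_def inner_A_def positive_operator_def)

lemma norm_A_add_scaleC_sq: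
  "(norm_A A (x + l *\<^sub>C y))\<^sup>2
    = (norm_A A x)\<^sup>2 + 2 * Re (cnj l * inner_A A x y) + (norm l)\<^sup>2 * (norm_A A y)\<^sup>2"
proof -
  have "inner_A A (x + l *\<^sub>C y) (x + l *\<^sub>C y)
      = inner_A A x x + (cnj l * inner_A A x y + cnj (cnj l * inner_A A x y))
        + l * cnj l * inner_A A y y"
    unfolding inner_A_add_left inner_A_add_right inner_A_scaleC_left inner_A_scaleC_right
    by (simp add: inner_A_commute[of y x] algebra_simps)
  then have "inner_A A (x + l *\<^sub>C y) (x + l *\<^sub>C y)
      = inner_A A x x + complex_of_real (2 * Re (cnj l * inner_A A x y))
        + complex_of_real ((norm l)\<^sup>2) * inner_A A y y"
    by (simp only: complex_add_cnj complex_mult_cnj cmod_power2)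
  then show ?thesis
    by (simp only: norm_A_sq plus_complex.sel Re_complex_of_real Re_mult_of_real)
qed

lemma norm_A_scaleC: "norm_A A (c *\<^sub>C x) = norm c * norm_A A x"
proof -
  have "(norm_A A (c *\<^sub>C x))\<^sup>2 = Re (complex_of_real ((norm c)\<^sup>2) * inner_A A x x)"
    by (simp only: norm_A_sq inner_A_scaleC_left inner_A_scaleC_right mult.assoc[symmetric]
        mult.commute[of "cnj c" c] complex_mult_cnj cmod_power2)
  also have "\<dots> = (norm c * norm_A A x)\<^sup>2"
    by (simp only: Re_mult_of_real norm_A_sq power_mult_distrib)
  finally show ?thesis
    by (simp add: norm_A_nonneg)
qed

text \<open>The expanded squares at \<open>c\<close> and at \<open>- c\<close> are both nonnegative,
  which bounds the cross term from either side. This weak form of Cauchy-Schwarz is enough to keep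
  cross terms bounded along a sequence.\<close>

lemma two_abs_Re_inner_A_le:
  assumes "norm c = 1"
  shows "2 * \<bar>Re (cnj c * inner_A A x y)\<bar> \<le> (norm_A A x)\<^sup>2 + (norm_A A y)\<^sup>2"
  using norm_A_add_scaleC_sq[of x c y] norm_A_add_scaleC_sq[of x "- c" y] assms
    zero_le_power2[of "norm_A A (x + c *\<^sub>C y)"] zero_le_power2[of "norm_A A (x + (- c) *\<^sub>C y)"]
  by (auto simp: abs_if)

text \<open>If the seminorm vanished identically, its expansion would make every cross term zero.
  Pairing \<open>x\<close> with \<open>A x\<close> then gives \<open>norm (A x) = 0\<close> for all
  \<open>x\<close>. Otherwise a vector of nonzero seminorm can be normalised.\<close>

lemma sphere_A_nonempty:
  assumes "A \<noteq> (\<lambda>x. 0)"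
  shows "sphere_A A \<noteq> {}"
proof -
  have "\<exists>x. norm_A A x \<noteq> 0"
  proof (rule ccontr)
    assume "\<nexists>x. norm_A A x \<noteq> 0"
    then have "Re (inner_A A x (A x)) = 0" for x
      using norm_A_add_scaleC_sq[of x 1 "A x"] by simp
    then have "norm (A x) = 0" for x
      unfolding inner_A_def norm_eq_sqrt_cinner by simp
    with assms show False by auto
  qed
  then obtain x where x: "norm_A A x \<noteq> 0" by blast
  then have "norm_A A (complex_of_real (1 / norm_A A x) *\<^sub>C x) = 1"
    using norm_A_nonneg[of x] by (simp only: norm_A_scaleC norm_of_real) simp
  then show ?thesis by (auto simp: sphere_A_def)
qed

section \<open>Suprema over the unit sphere of the seminorm\<close>

definition bounded_on_sphere :: "('h \<Rightarrow> 'h) \<Rightarrow> bool"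
  where "bounded_on_sphere T \<longleftrightarrow> bdd_above ((\<lambda>x. norm_A A (T x)) ` sphere_A A)"

lemma A_bounded_operators_bounded_on_sphere:
  assumes "T \<in> A_bounded_operators A"
  shows "bounded_on_sphere T"
proof -
  obtain c where c: "\<And>x. norm_A A (T x) \<le> c * norm_A A x"
    using assms by (auto simp: A_bounded_operators_def)
  have "norm_A A (T x) \<le> c" if "x \<in> sphere_A A" for x
    using c[of x] that by (simp add: sphere_A_def)
  then show ?thesis
    unfolding bounded_on_sphere_def by (rule bdd_aboveI2)
qed

lemma norm_A_le_opnorm_A:
  assumes "bounded_on_sphere T" "x \<in> sphere_A A"
  shows "norm_A A (T x) \<le> opnorm_A A T"
  using assms unfolding bounded_on_sphere_def opnorm_A_def by (rule cSUP_upper[rotated])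

lemma norm_A_sq_le_opnorm_A_sq:
  assumes "bounded_on_sphere T" "x \<in> sphere_A A"
  shows "(norm_A A (T x))\<^sup>2 \<le> (opnorm_A A T)\<^sup>2"
  using norm_A_le_opnorm_A[OF assms] norm_A_nonneg by (rule power_mono)

lemma opnorm_A_nonneg:
  assumes "bounded_on_sphere T" "sphere_A A \<noteq> {}"
  shows "0 \<le> opnorm_A A T"
  using assms norm_A_le_opnorm_A norm_A_nonneg by (meson all_not_in_conv order_trans)

lemma opnorm_A_sq_approx:
  assumes "bounded_on_sphere T" "sphere_A A \<noteq> {}" "0 < d"
  obtains x where "x \<in> sphere_A A" "(opnorm_A A T)\<^sup>2 - d < (norm_A A (T x))\<^sup>2"
proof -
  have "\<exists>x\<in>sphere_A A. (opnorm_A A T)\<^sup>2 - d < (norm_A A (T x))\<^sup>2"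
  proof (rule ccontr)
    assume "\<not> ?thesis"
    then have le: "(norm_A A (T x))\<^sup>2 \<le> (opnorm_A A T)\<^sup>2 - d" if "x \<in> sphere_A A" for x
      using that by force
    \<comment> \<open>Nonemptiness of the sphere makes the radicand below nonnegative, so squaring
      really undoes the square root.\<close>
    then have "0 \<le> (opnorm_A A T)\<^sup>2 - d"
      using assms(2) by (meson all_not_in_conv order_trans zero_le_power2)
    moreover have "opnorm_A A T \<le> sqrt ((opnorm_A A T)\<^sup>2 - d)"
      unfolding opnorm_A_def[of A T]
      by (rule cSUP_least[OF assms(2)]) (use le in \<open>auto intro: real_le_rsqrt simp: opnorm_A_def\<close>)
    ultimately have "(opnorm_A A T)\<^sup>2 \<le> (opnorm_A A T)\<^sup>2 - d"
      using power_mono[of "opnorm_A A T" _ 2] opnorm_A_nonneg[OF assms(1,2)]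
      by (metis real_sqrt_pow2)
    with assms(3) show False by simp
  qed
  then show ?thesis using that by blast
qed

text \<open>Makes the error term of the orthogonality condition linear in \<open>norm l\<close>. The
  reverse inequality divides by \<open>norm l\<close>, hence the separate case
  \<open>l = 0\<close>.\<close>

lemma opnorm_A_scaleC:
  assumes "bounded_on_sphere S" "sphere_A A \<noteq> {}"
  shows "opnorm_A A (\<lambda>x. l *\<^sub>C S x) = norm l * opnorm_A A S"
proof (rule antisym)
  have le: "norm_A A (l *\<^sub>C S x) \<le> norm l * opnorm_A A S" if "x \<in> sphere_A A" for x
    using norm_A_le_opnorm_A[OF assms(1) that] by (simp add: norm_A_scaleC mult_left_mono)
  then show "opnorm_A A (\<lambda>x. l *\<^sub>C S x) \<le> norm l * opnorm_A A S"
    unfolding opnorm_A_def[of A "\<lambda>x. l *\<^sub>C S x"] by (intro cSUP_least[OF assms(2)])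
  have bd: "bounded_on_sphere (\<lambda>x. l *\<^sub>C S x)"
    unfolding bounded_on_sphere_def using le by (intro bdd_aboveI2)
  show "norm l * opnorm_A A S \<le> opnorm_A A (\<lambda>x. l *\<^sub>C S x)"
  proof (cases "l = 0")
    case True
    then show ?thesis using opnorm_A_nonneg[OF bd assms(2)] by simp
  next
    case False
    have "opnorm_A A S \<le> opnorm_A A (\<lambda>x. l *\<^sub>C S x) / norm l"
      unfolding opnorm_A_def[of A S]
      by (rule cSUP_least[OF assms(2)])
        (use False norm_A_le_opnorm_A[OF bd] in \<open>auto simp: norm_A_scaleC field_simps\<close>)
    with False show ?thesis by (simp add: field_simps)
  qed
qed

text \<open>Parallelogram argument: adding the nonnegative square for \<open>- l\<close> to the
  square for \<open>l\<close> cancels the cross terms.\<close>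

lemma bounded_on_sphere_add_scaleC:
  assumes T: "bounded_on_sphere T" and S: "bounded_on_sphere S"
  shows "bounded_on_sphere (\<lambda>x. T x + l *\<^sub>C S x)"
proof -
  have "norm_A A (T x + l *\<^sub>C S x)
      \<le> sqrt (2 * (opnorm_A A T)\<^sup>2 + 2 * ((norm l)\<^sup>2 * (opnorm_A A S)\<^sup>2))" if "x \<in> sphere_A A" for x
  proof (rule real_le_rsqrt)
    have "0 \<le> (norm_A A (T x + (- l) *\<^sub>C S x))\<^sup>2" by simp
    then have "(norm_A A (T x + l *\<^sub>C S x))\<^sup>2
        \<le> 2 * (norm_A A (T x))\<^sup>2 + 2 * ((norm l)\<^sup>2 * (norm_A A (S x))\<^sup>2)"
      unfolding norm_A_add_scaleC_sq by simp
    also have "\<dots> \<le> 2 * (opnorm_A A T)\<^sup>2 + 2 * ((norm l)\<^sup>2 * (opnorm_A A S)\<^sup>2)"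
      using norm_A_sq_le_opnorm_A_sq[OF T that] norm_A_sq_le_opnorm_A_sq[OF S that]
      by (intro add_mono mult_left_mono) auto
    finally show "(norm_A A (T x + l *\<^sub>C S x))\<^sup>2
        \<le> 2 * (opnorm_A A T)\<^sup>2 + 2 * ((norm l)\<^sup>2 * (opnorm_A A S)\<^sup>2)" .
  qed
  then show ?thesis
    unfolding bounded_on_sphere_def by (rule bdd_aboveI2)
qed

section \<open>Perturbation along one ray and maximising sequences\<close>

lemma norm_A_add_real_scaleC_sq:
  assumes "norm c = 1"
  shows "(norm_A A (x + (complex_of_real t * c) *\<^sub>C y))\<^sup>2
    = (norm_A A x)\<^sup>2 + 2 * t * Re (cnj c * inner_A A x y) + t\<^sup>2 * (norm_A A y)\<^sup>2"
  using assms
  by (simp only: norm_A_add_scaleC_sq complex_cnj_mult complex_cnj_complex_of_real mult.assoc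
      Re_mult_of_real norm_mult norm_of_real mult_1_right power2_abs)

lemma opnorm_A_sq_ge_if_sequence:
  assumes T: "bounded_on_sphere T" and S: "bounded_on_sphere S"
    and c: "norm c = 1" and t: "0 \<le> t"
    and x: "range x \<subseteq> sphere_A A"
    and Tx: "(\<lambda>n. norm_A A (T (x n))) \<longlonglongrightarrow> opnorm_A A T"
    and b: "(\<lambda>n. Re (cnj c * inner_A A (T (x n)) (S (x n)))) \<longlonglongrightarrow> b" "- K \<le> b"
  shows "(opnorm_A A T)\<^sup>2 - 2 * t * K \<le> (opnorm_A A (\<lambda>x. T x + (complex_of_real t * c) *\<^sub>C S x))\<^sup>2"
proof -
  let ?R = "\<lambda>x. T x + (complex_of_real t * c) *\<^sub>C S x"
  have "(norm_A A (T (x n)))\<^sup>2 + 2 * t * Re (cnj c * inner_A A (T (x n)) (S (x n)))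
      \<le> (opnorm_A A ?R)\<^sup>2" for n
  proof -
    have "(norm_A A (?R (x n)))\<^sup>2 \<le> (opnorm_A A ?R)\<^sup>2"
      using x by (intro norm_A_sq_le_opnorm_A_sq bounded_on_sphere_add_scaleC T S) auto
    \<comment> \<open>Dropping the quadratic term leaves only quantities whose limits are
      given.\<close>
    moreover have "0 \<le> t\<^sup>2 * (norm_A A (S (x n)))\<^sup>2" by simp
    ultimately show ?thesis
      unfolding norm_A_add_real_scaleC_sq[OF c] by linarith
  qed
  moreover have "(\<lambda>n. (norm_A A (T (x n)))\<^sup>2 + 2 * t * Re (cnj c * inner_A A (T (x n)) (S (x n))))
      \<longlonglongrightarrow> (opnorm_A A T)\<^sup>2 + 2 * t * b"
    by (intro tendsto_intros Tx b)
  ultimately have "(opnorm_A A T)\<^sup>2 + 2 * t * b \<le> (opnorm_A A ?R)\<^sup>2"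
    by (intro LIMSEQ_le_const2) auto
  moreover have "2 * t * (- K) \<le> 2 * t * b"
    using t b(2) by (intro mult_left_mono) auto
  ultimately show ?thesis by linarith
qed

lemma sequence_if_opnorm_A_sq_ge:
  assumes T: "bounded_on_sphere T" and S: "bounded_on_sphere S" and ne: "sphere_A A \<noteq> {}"
    and c: "norm c = 1"
    and ge: "\<And>t. 0 \<le> t \<Longrightarrow>
      (opnorm_A A T)\<^sup>2 - 2 * t * K \<le> (opnorm_A A (\<lambda>x. T x + (complex_of_real t * c) *\<^sub>C S x))\<^sup>2"
  obtains x b where "range x \<subseteq> sphere_A A"
    "(\<lambda>n. norm_A A (T (x n))) \<longlonglongrightarrow> opnorm_A A T"
    "(\<lambda>n. Re (cnj c * inner_A A (T (x n)) (S (x n)))) \<longlonglongrightarrow> b" "- K \<le> b"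
proof -
  define M N where "M = opnorm_A A T" and "N = opnorm_A A S"
  define t :: "nat \<Rightarrow> real" where "t n = inverse (of_nat (Suc n))" for n
  let ?R = "\<lambda>n x. T x + (complex_of_real (t n) * c) *\<^sub>C S x"
  have t: "0 < t n" "t n \<le> 1" for n
    by (auto simp: t_def inverse_le_1_iff)
  have t0: "t \<longlonglongrightarrow> 0"
    unfolding t_def by (rule LIMSEQ_inverse_real_of_nat)
  \<comment> \<open>The tolerance is of order \<open>t^2\<close> so that it still tends to 0 after
    the division by \<open>t\<close> that isolates the cross term.\<close>
  have "\<exists>x\<in>sphere_A A. (opnorm_A A (?R n))\<^sup>2 - (t n)\<^sup>2 < (norm_A A (?R n x))\<^sup>2" for n
    using opnorm_A_sq_approx[OF bounded_on_sphere_add_scaleC[OF T S] ne]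
    by (metis t(1) zero_less_power)
  then obtain x where x: "\<And>n. x n \<in> sphere_A A"
    and R: "\<And>n. (opnorm_A A (?R n))\<^sup>2 - (t n)\<^sup>2 < (norm_A A (?R n (x n)))\<^sup>2"
    by metis
  define r where "r n = Re (cnj c * inner_A A (T (x n)) (S (x n)))" for n
  have TM: "(norm_A A (T (x n)))\<^sup>2 \<le> M\<^sup>2" and SN: "(norm_A A (S (x n)))\<^sup>2 \<le> N\<^sup>2" for n
    using norm_A_sq_le_opnorm_A_sq[OF T x] norm_A_sq_le_opnorm_A_sq[OF S x] by (auto simp: M_def N_def)
  have r_bound: "\<bar>r n\<bar> \<le> M\<^sup>2 + N\<^sup>2" for n
    using two_abs_Re_inner_A_le[OF c, of "T (x n)" "S (x n)"] TM[of n] SN[of n]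
    unfolding r_def by linarith
  have main: "M\<^sup>2 - 2 * t n * K - (t n)\<^sup>2 \<le> (norm_A A (T (x n)))\<^sup>2 + 2 * t n * r n + (t n)\<^sup>2 * N\<^sup>2" for n
  proof -
    have "M\<^sup>2 - 2 * t n * K - (t n)\<^sup>2 \<le> (norm_A A (?R n (x n)))\<^sup>2"
      using R[of n] ge[of "t n"] t(1)[of n] by (simp add: M_def)
    also have "\<dots> = (norm_A A (T (x n)))\<^sup>2 + 2 * t n * r n + (t n)\<^sup>2 * (norm_A A (S (x n)))\<^sup>2"
      unfolding norm_A_add_real_scaleC_sq[OF c] r_def ..
    finally show ?thesis
      using mult_left_mono[OF SN, of "(t n)\<^sup>2" n] by simp
  qed
  \<comment> \<open>Bounding \<open>norm_A A (T (x n))\<close> by \<open>M\<close> in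
    \<open>main\<close> cancels the zeroth-order terms; what remains is divided by
    \<open>2 * t n\<close>.\<close>
  have r_ge: "- K - t n * ((N\<^sup>2 + 1) / 2) \<le> r n" for n
  proof -
    have "t n * (2 * (- K - t n * ((N\<^sup>2 + 1) / 2))) = - 2 * t n * K - (t n)\<^sup>2 - (t n)\<^sup>2 * N\<^sup>2"
      by (simp add: field_simps power2_eq_square)
    also have "\<dots> \<le> t n * (2 * r n)"
      using main[of n] TM[of n] by simp
    finally show ?thesis
      using t(1)[of n] by (simp add: mult_le_cancel_left_pos)
  qed
  \<comment> \<open>Same inequality \<open>main\<close>, read the other way: with \<open>r n\<close>
    bounded, every correction to \<open>M^2\<close> vanishes as \<open>t n\<close> tends to
    0.\<close>
  have "(\<lambda>n. (norm_A A (T (x n)))\<^sup>2) \<longlonglongrightarrow> M\<^sup>2"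
  proof (rule tendsto_sandwich)
    show "\<forall>\<^sub>F n in sequentially.
        M\<^sup>2 - 2 * t n * K - (t n)\<^sup>2 - 2 * t n * (M\<^sup>2 + N\<^sup>2) - (t n)\<^sup>2 * N\<^sup>2 \<le> (norm_A A (T (x n)))\<^sup>2"
    proof (rule always_eventually, rule allI)
      fix n
      have "2 * t n * r n \<le> 2 * t n * (M\<^sup>2 + N\<^sup>2)"
        using t(1)[of n] r_bound[of n] by (intro mult_left_mono) auto
      with main[of n]
      show "M\<^sup>2 - 2 * t n * K - (t n)\<^sup>2 - 2 * t n * (M\<^sup>2 + N\<^sup>2) - (t n)\<^sup>2 * N\<^sup>2 \<le> (norm_A A (T (x n)))\<^sup>2"
        by linarith
    qed
    have "(\<lambda>n. M\<^sup>2 - 2 * t n * K - (t n)\<^sup>2 - 2 * t n * (M\<^sup>2 + N\<^sup>2) - (t n)\<^sup>2 * N\<^sup>2)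
        \<longlonglongrightarrow> M\<^sup>2 - 2 * 0 * K - 0\<^sup>2 - 2 * 0 * (M\<^sup>2 + N\<^sup>2) - 0\<^sup>2 * N\<^sup>2"
      by (intro tendsto_intros t0)
    then show "(\<lambda>n. M\<^sup>2 - 2 * t n * K - (t n)\<^sup>2 - 2 * t n * (M\<^sup>2 + N\<^sup>2) - (t n)\<^sup>2 * N\<^sup>2) \<longlonglongrightarrow> M\<^sup>2"
      by simp
  qed (use TM in auto)
  from tendsto_real_sqrt[OF this] have Tx: "(\<lambda>n. norm_A A (T (x n))) \<longlonglongrightarrow> M"
    using opnorm_A_nonneg[OF T ne] by (simp add: norm_A_nonneg M_def)
  have "bounded (range r)"
    using r_bound by (auto intro!: boundedI)
  \<comment> \<open>The cross terms are only known to be bounded; the subsequence supplies an actual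
    limit and keeps the convergence to \<open>M\<close>.\<close>
  then obtain b s where s: "strict_mono (s :: nat \<Rightarrow> nat)" and b: "(r \<circ> s) \<longlonglongrightarrow> b"
    using bounded_imp_convergent_subsequence by blast
  have "(\<lambda>n. - K - t (s n) * ((N\<^sup>2 + 1) / 2)) \<longlonglongrightarrow> - K - 0 * ((N\<^sup>2 + 1) / 2)"
    by (intro tendsto_intros LIMSEQ_subseq_LIMSEQ[OF t0 s, unfolded o_def])
  then have "- K \<le> b"
    using r_ge b by (intro LIMSEQ_le[of _ "- K" "r \<circ> s"]) auto
  moreover have "(\<lambda>n. norm_A A (T (x (s n)))) \<longlonglongrightarrow> opnorm_A A T"
    using LIMSEQ_subseq_LIMSEQ[OF Tx s] by (simp add: o_def M_def)
  moreover have "(\<lambda>n. Re (cnj c * inner_A A (T (x (s n))) (S (x (s n))))) \<longlonglongrightarrow> b"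
    using b by (simp add: o_def r_def)
  ultimately show ?thesis
    using that[of "x \<circ> s" b] x by auto
qed

end

section \<open>Combining opposite rays over all angles\<close>

theorem theorem2p8:
  fixes A T S :: "'h::complex_hilbert \<Rightarrow> 'h" and \<epsilon> :: real
  assumes "positive_operator A" and "A \<noteq> (\<lambda>x. 0)"
    and "0 \<le> \<epsilon>" and "\<epsilon> < 1"
    and "T \<in> A_bounded_operators A" and "S \<in> A_bounded_operators A"
  shows "approx_orthogonal_A \<epsilon> A T S \<longleftrightarrow>
    (\<forall>\<theta>::real. 0 \<le> \<theta> \<and> \<theta> < pi \<longrightarrow>
      (\<exists>x y :: nat \<Rightarrow> 'h.
        range x \<subseteq> sphere_A A \<and> range y \<subseteq> sphere_A A \<and>
        (\<lambda>n. norm_A A (T (x n))) \<longlonglongrightarrow> opnorm_A A T \<and>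
        (\<lambda>n. norm_A A (T (y n))) \<longlonglongrightarrow> opnorm_A A T \<and>
        (\<exists>b. (\<lambda>n. Re (exp (- \<i> * complex_of_real \<theta>) * inner_A A (T (x n)) (S (x n)))) \<longlonglongrightarrow> b \<and>
             b \<ge> - \<epsilon> * opnorm_A A T * opnorm_A A S) \<and>
        (\<exists>c. (\<lambda>n. Re (exp (- \<i> * complex_of_real \<theta>) * inner_A A (T (y n)) (S (y n)))) \<longlonglongrightarrow> c \<and>
             c \<le> \<epsilon> * opnorm_A A T * opnorm_A A S)))"
proof -
  let ?M = "opnorm_A A T" and ?N = "opnorm_A A S"
  let ?c = "\<lambda>\<theta>::real. exp (\<i> * complex_of_real \<theta>)"
  note pos = assms(1)
  note T = A_bounded_operators_bounded_on_sphere[OF pos assms(5)]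
  note S = A_bounded_operators_bounded_on_sphere[OF pos assms(6)]
  note ne = sphere_A_nonempty[OF pos assms(2)]
  define K where "K = \<epsilon> * ?M * ?N"
  have cnj_c: "cnj (?c \<theta>) = exp (- \<i> * complex_of_real \<theta>)" for \<theta>
    by (simp add: exp_cnj)
  have norm_c: "norm (?c \<theta>) = 1" "norm (- ?c \<theta>) = 1" for \<theta>
    by simp_all
  have orth: "approx_orthogonal_A \<epsilon> A T S \<longleftrightarrow>
      (\<forall>l. ?M\<^sup>2 - 2 * norm l * K \<le> (opnorm_A A (\<lambda>x. T x + l *\<^sub>C S x))\<^sup>2)"
    unfolding approx_orthogonal_A_def opnorm_A_scaleC[OF pos S ne] K_def
    by (simp add: mult_ac)
  show ?thesis (is "_ \<longleftrightarrow> (\<forall>\<theta>. _ \<longrightarrow> ?seqs \<theta>)")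
  proof (intro iffI allI impI)
    fix \<theta> :: real
    assume "approx_orthogonal_A \<epsilon> A T S"
    then have ge: "?M\<^sup>2 - 2 * t * K \<le> (opnorm_A A (\<lambda>x. T x + (complex_of_real t * c) *\<^sub>C S x))\<^sup>2"
      if "0 \<le> t" "norm c = 1" for t c
      using \<open>approx_orthogonal_A \<epsilon> A T S\<close>[unfolded orth, rule_format, of "complex_of_real t * c"] that
      by (simp add: norm_mult)
    obtain x b where x: "range x \<subseteq> sphere_A A" "(\<lambda>n. norm_A A (T (x n))) \<longlonglongrightarrow> ?M"
      "(\<lambda>n. Re (cnj (?c \<theta>) * inner_A A (T (x n)) (S (x n)))) \<longlonglongrightarrow> b" "- K \<le> b"
      using sequence_if_opnorm_A_sq_ge[OF pos T S ne norm_c(1) ge[OF _ norm_c(1)]] .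
    \<comment> \<open>On the opposite ray the cross term changes sign, so the lower bound
      \<open>- K\<close> for \<open>b'\<close> becomes the upper bound \<open>K\<close> for the
      limit \<open>- b'\<close> in (c).\<close>
    obtain y b' where y: "range y \<subseteq> sphere_A A" "(\<lambda>n. norm_A A (T (y n))) \<longlonglongrightarrow> ?M"
      "(\<lambda>n. Re (cnj (- ?c \<theta>) * inner_A A (T (y n)) (S (y n)))) \<longlonglongrightarrow> b'" "- K \<le> b'"
      using sequence_if_opnorm_A_sq_ge[OF pos T S ne norm_c(2) ge[OF _ norm_c(2)]] .
    have "(\<lambda>n. Re (cnj (?c \<theta>) * inner_A A (T (y n)) (S (y n)))) \<longlonglongrightarrow> - b'"
      using tendsto_minus[OF y(3)] by (simp add: algebra_simps)
    with x y(1,2,4) show "?seqs \<theta>"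
      unfolding cnj_c K_def
      by (intro exI[of _ x] exI[of _ y] conjI exI[of _ b] exI[of _ "- b'"]) auto
  next
    assume seqs: "\<forall>\<theta>. 0 \<le> \<theta> \<and> \<theta> < pi \<longrightarrow> ?seqs \<theta>"
    show "approx_orthogonal_A \<epsilon> A T S"
      unfolding orth
    proof
      fix l
      obtain t \<theta> where \<theta>: "0 \<le> \<theta>" "\<theta> < pi" and l: "l = complex_of_real t * ?c \<theta>"
        by (rule complex_half_plane_polar)
      from seqs \<theta> obtain x y b c where xy: "range x \<subseteq> sphere_A A" "range y \<subseteq> sphere_A A"
        "(\<lambda>n. norm_A A (T (x n))) \<longlonglongrightarrow> ?M" "(\<lambda>n. norm_A A (T (y n))) \<longlonglongrightarrow> ?M"
        and b: "(\<lambda>n. Re (cnj (?c \<theta>) * inner_A A (T (x n)) (S (x n)))) \<longlonglongrightarrow> b" "- K \<le> b"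
        and c: "(\<lambda>n. Re (cnj (?c \<theta>) * inner_A A (T (y n)) (S (y n)))) \<longlonglongrightarrow> c" "c \<le> K"
        unfolding cnj_c K_def by auto
      \<comment> \<open>The sign of \<open>t\<close> decides which sequence is used:
        \<open>x\<close> on the ray of \<open>?c \<theta>\<close>, \<open>y\<close> on the opposite
        one, where \<open>l\<close> has the nonnegative radius \<open>- t\<close>.\<close>
      show "?M\<^sup>2 - 2 * norm l * K \<le> (opnorm_A A (\<lambda>x. T x + l *\<^sub>C S x))\<^sup>2"
      proof (cases "0 \<le> t")
        case True
        with opnorm_A_sq_ge_if_sequence[OF pos T S norm_c(1) True xy(1,3) b] show ?thesis
          by (simp add: l norm_mult)
      next
        case False
        have c': "(\<lambda>n. Re (cnj (- ?c \<theta>) * inner_A A (T (y n)) (S (y n)))) \<longlonglongrightarrow> - c" "- K \<le> - c"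
          using tendsto_minus[OF c(1)] c(2) by (simp_all add: algebra_simps)
        have "0 \<le> - t" using False by simp
        from opnorm_A_sq_ge_if_sequence[OF pos T S norm_c(2) this xy(2,4) c'] False show ?thesis
          by (simp add: l norm_mult)
      qed
    qed
  qed
qed

end
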